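(* Let $m\in C_K$, $m\neq0$. Consider the system $[\widehat\Omega_m]\colon Z_1'=-(\widehat\Omega_0+m\widehat N_3)Z_1$. Let $T_{2,m}$ be the matrix $$T_{2,m}=SP_{2,m}S^{-1}=\frac1{2r}\begin{pmatrix}w^2+\rho^2+\theta_0^2+\frac{\nu^2}{w^2}&2{\rm i}\big(w\theta_0-\frac{\nu\rho}{w}\big)&{\rm i}\big(w^2+\rho^2-\theta_0^2-\frac{\nu^2}{w^2}\big)\\[1mm]2{\rm i}\big(w\rho-\frac{\nu\theta_0}{w}\big)&2(\nu-\rho\theta_0)&-2\big(w\rho+\frac{\nu\theta_0}{w}\big)\\[1mm]{\rm i}\big(w^2-\rho^2+\theta_0^2-\frac{\nu^2}{w^2}\big)&-2\big(w\theta_0+\frac{\nu\rho}{w}\big)&-w^2+\rho^2+\theta_0^2-\frac{\nu^2}{w^2}\end{pmatrix},$$ where $\nu=mr-\theta_0\rho$. Then the gauge transformation $T_{2,m}$ is a Darboux transformation for the system $[\widehat\Omega_m]$.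
   Context: $K$ is a differential field of characteristic zero with derivation $'$ and algebraically closed field of constants $C_K$; ${\rm i}\in C_K$ with ${\rm i}^2=-1$. Let $p,q,r\in K$, $r\neq0$, $p=w'/w$ for a fixed nonzero $w\in K$. Let $y_0$ be a nonzero solution of $y''+py'+qy=0$ (in a Picard--Vessiot extension of $K$), $\theta_0:=y_0'/y_0$, $\rho:=-\theta_0-p-\frac{r'}{2r}$, $\nu:=mr-\rho\theta_0$, $\sqrt r$ a square root of $r$, and $$\tilde q:=y_0\sqrt r\left(\frac{p}{y_0\sqrt r}-\Big(\frac1{y_0\sqrt r}\Big)'\right)'.$$ Set $$S=\begin{pmatrix}1&0&1\\0&{\rm i}&0\\{\rm i}&0&-{\rm i}\end{pmatrix},\qquad P_{2,m}=\frac1r\begin{pmatrix}\theta_0^2&-w\theta_0&w^2\\ \frac{-2\theta_0\nu}{w}&\nu-\rho\theta_0&2w\rho\\ \frac{\nu^2}{w^2}&\frac{\rho\nu}{w}&\rho^2\end{pmatrix},$$ $$\widehat\Omega_0=\begin{pmatrix}0&{\rm i}(\frac1w-wq)&0\\-{\rm i}(\frac1w-wq)&0&\frac1w+wq\\0&-(\frac1w+wq)&0\end{pmatrix},\qquad \widehat N_3=wr\begin{pmatrix}0&{\rm i}&0\\-{\rm i}&0&-1\\0&1&0\end{pmatrix},$$ and let $\widetilde{\widehat\Omega}_0$ be obtained from $\widehat\Omega_0$ by replacing $q$ by $\tilde q$. A gauge transformation is an invertible linear change of the unknown vector. That $T_{2,m}$ is a Darboux transformation for $[\widehat\Omega_m]$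 means that $\widetilde Z_1=T_{2,m}Z_1$ sends $[\widehat\Omega_m]$ to the system $\widetilde Z_1'=-(\widetilde{\widehat\Omega}_0+m\widehat N_3)\widetilde Z_1$ of the same shape.
   Formalization: The identity T=SPS^{-1} is proved as displayed, but the Darboux property is proved for T_{2,m} with each w in the displayed matrix replaced by 1/w; with w itself it fails, e.g. for zero derivation, p=q=0, r=1, w=2, m=1, y_0=1. *)

theory Defs
  imports "HOL-Analysis.Analysis"
begin

text \<open>
  All fields live inside one ambient field \<^typ>\<open>'a\<close> of characteristic zero with a derivation
  \<open>D\<close>; the base field and its extensions are differential subfields of it, given as sets.
\<close>

definition is_derivation :: "('a::field_char_0 \<Rightarrow> 'a) \<Rightarrow> bool" where
  "is_derivation D \<longleftrightarrow> (\<forall>x y. D (x + y) = D x + D y) \<and> (\<forall>x y. D (x * y) = D x * y + x * D y)"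

definition is_subfield :: "'a::field_char_0 set \<Rightarrow> bool" where
  "is_subfield K \<longleftrightarrow> 1 \<in> K \<and> (\<forall>x\<in>K. \<forall>y\<in>K. x - y \<in> K) \<and> (\<forall>x\<in>K. \<forall>y\<in>K. x * y \<in> K) \<and>
     (\<forall>x\<in>K. inverse x \<in> K)"

definition differential_subfield :: "('a::field_char_0 \<Rightarrow> 'a) \<Rightarrow> 'a set \<Rightarrow> bool" where
  "differential_subfield D K \<longleftrightarrow> is_subfield K \<and> (\<forall>x\<in>K. D x \<in> K)"

definition constants :: "('a::field_char_0 \<Rightarrow> 'a) \<Rightarrow> 'a set \<Rightarrow> 'a set" where
  "constants D K = {c \<in> K. D c = 0}"

definition algebraically_closed_subfield :: "'a::field_char_0 set \<Rightarrow> bool" where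
  "algebraically_closed_subfield C \<longleftrightarrow> is_subfield C \<and>
     (\<forall>f :: 'a poly. (\<forall>k. coeff f k \<in> C) \<and> degree f > 0 \<longrightarrow> (\<exists>c\<in>C. poly f c = 0))"

definition solves_equation :: "('a::field_char_0 \<Rightarrow> 'a) \<Rightarrow> 'a \<Rightarrow> 'a \<Rightarrow> 'a \<Rightarrow> bool" where
  "solves_equation D p q y \<longleftrightarrow> D (D y) + p * D y + q * y = 0"

definition picard_vessiot ::
    "('a::field_char_0 \<Rightarrow> 'a) \<Rightarrow> 'a set \<Rightarrow> 'a \<Rightarrow> 'a \<Rightarrow> 'a set \<Rightarrow> bool" where
  "picard_vessiot D K p q L \<longleftrightarrow>
     differential_subfield D L \<and> K \<subseteq> L \<and> constants D L = constants D K \<and>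
     (\<exists>y1\<in>L. \<exists>y2\<in>L. solves_equation D p q y1 \<and> solves_equation D p q y2 \<and>
        y1 * D y2 - y2 * D y1 \<noteq> 0 \<and>
        (\<forall>F. differential_subfield D F \<and> K \<subseteq> F \<and> y1 \<in> F \<and> y2 \<in> F \<longrightarrow> L \<subseteq> F))"

definition q_tilde :: "('a::field_char_0 \<Rightarrow> 'a) \<Rightarrow> 'a \<Rightarrow> 'a \<Rightarrow> 'a \<Rightarrow> 'a" where
  "q_tilde D p y0 sqrt_r =
     y0 * sqrt_r * D (p / (y0 * sqrt_r) - D (1 / (y0 * sqrt_r)))"

definition S_mat :: "'a::field_char_0 \<Rightarrow> 'a^3^3" where
  "S_mat im = vector [vector [1, 0, 1], vector [0, im, 0], vector [im, 0, - im]]"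

text \<open>
  In \<open>P2\<close> and \<open>T2\<close> the argument \<open>u\<close> is to be instantiated by \<open>1 / w\<close>, not by \<open>w\<close>.  The matrix
  \<open>Omega0_hat im w q\<close> with \<open>p = D w / w\<close> arises from the unknowns \<open>y\<^sup>2, 2 y (w y'), (w y')\<^sup>2\<close> by
  applying \<open>S_mat\<close>; in these, the map \<open>y \<mapsto> (y' - \<theta> y) / sqrt_r\<close> is given by \<open>P2 (1 / w)\<close>.  For \<open>u = w\<close>
  the gauge transformation fails in general, e.g. for constant \<open>w = 2\<close>.
\<close>

definition P2 :: "'a::field_char_0 \<Rightarrow> 'a \<Rightarrow> 'a \<Rightarrow> 'a \<Rightarrow> 'a \<Rightarrow> 'a^3^3" where
  "P2 u r \<theta> \<rho> \<nu> = mat (1 / r) ** vector [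
     vector [\<theta>^2, - u * \<theta>, u^2],
     vector [- 2 * \<theta> * \<nu> / u, \<nu> - \<rho> * \<theta>, 2 * u * \<rho>],
     vector [\<nu>^2 / u^2, \<rho> * \<nu> / u, \<rho>^2]]"

definition T2 :: "'a::field_char_0 \<Rightarrow> 'a \<Rightarrow> 'a \<Rightarrow> 'a \<Rightarrow> 'a \<Rightarrow> 'a \<Rightarrow> 'a^3^3" where
  "T2 im u r \<theta> \<rho> \<nu> = mat (1 / (2 * r)) ** vector [
     vector [u^2 + \<rho>^2 + \<theta>^2 + \<nu>^2 / u^2,
             2 * im * (u * \<theta> - \<nu> * \<rho> / u),
             im * (u^2 + \<rho>^2 - \<theta>^2 - \<nu>^2 / u^2)],
     vector [2 * im * (u * \<rho> - \<nu> * \<theta> / u),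
             2 * (\<nu> - \<rho> * \<theta>),
             - 2 * (u * \<rho> + \<nu> * \<theta> / u)],
     vector [im * (u^2 - \<rho>^2 + \<theta>^2 - \<nu>^2 / u^2),
             - 2 * (u * \<theta> + \<nu> * \<rho> / u),
             - (u^2) + \<rho>^2 + \<theta>^2 - \<nu>^2 / u^2]]"

definition Omega0_hat :: "'a::field_char_0 \<Rightarrow> 'a \<Rightarrow> 'a \<Rightarrow> 'a^3^3" where
  "Omega0_hat im w q = vector [
     vector [0, im * (1 / w - w * q), 0],
     vector [- im * (1 / w - w * q), 0, 1 / w + w * q],
     vector [0, - (1 / w + w * q), 0]]"

definition N3_hat :: "'a::field_char_0 \<Rightarrow> 'a \<Rightarrow> 'a \<Rightarrow> 'a^3^3" where
  "N3_hat im w r = mat (w * r) ** vector [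
     vector [0, im, 0], vector [- im, 0, - 1], vector [0, 1, 0]]"

definition Omega_hat :: "'a::field_char_0 \<Rightarrow> 'a \<Rightarrow> 'a \<Rightarrow> 'a \<Rightarrow> 'a \<Rightarrow> 'a^3^3" where
  "Omega_hat im w r q m = Omega0_hat im w q + mat m ** N3_hat im w r"

definition solves_system :: "('a::field_char_0 \<Rightarrow> 'a) \<Rightarrow> 'a^'n^'n \<Rightarrow> 'a^'n \<Rightarrow> bool" where
  "solves_system D A Z \<longleftrightarrow> (\<chi> i. D (Z $ i)) = - (A *v Z)"

text \<open>
  If \<open>Z' = - A Z\<close> then \<open>T Z\<close> has derivative \<open>- (T A - T') T\<^sup>-\<^sup>1 (T Z)\<close>.  The correspondence of
  solutions alone could be vacuous, since the ambient field need not contain a fundamental system,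
  so the coefficient matrix of the transformed system is prescribed as well.
\<close>

definition gauge_matrix :: "('a::field_char_0 \<Rightarrow> 'a) \<Rightarrow> 'a^'n^'n \<Rightarrow> 'a^'n^'n \<Rightarrow> 'a^'n^'n" where
  "gauge_matrix D T A = (T ** A - map_matrix D T) ** matrix_inv T"

definition gauge_transformation ::
    "('a::field_char_0 \<Rightarrow> 'a) \<Rightarrow> 'a^'n^'n \<Rightarrow> 'a^'n^'n \<Rightarrow> 'a^'n^'n \<Rightarrow> bool" where
  "gauge_transformation D T A B \<longleftrightarrow> invertible T \<and> gauge_matrix D T A = B \<and>
     (\<forall>Z. solves_system D A Z \<longleftrightarrow> solves_system D B (T *v Z))"

text \<open>
  \<open>T\<close> is a Darboux transformation for the system with matrix \<open>Omega_hat im w r q m\<close>: the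
  transformed system has the same shape, with the potential \<open>q\<close> replaced by \<open>q'\<close>.
\<close>

definition darboux_transformation ::
    "('a::field_char_0 \<Rightarrow> 'a) \<Rightarrow> 'a \<Rightarrow> 'a \<Rightarrow> 'a \<Rightarrow> 'a \<Rightarrow> 'a \<Rightarrow> 'a \<Rightarrow> 'a^3^3 \<Rightarrow> bool" where
  "darboux_transformation D im w r q q' m T \<longleftrightarrow>
     gauge_transformation D T (Omega_hat im w r q m) (Omega_hat im w r q' m)"

end

theory Submission
  imports Defs
begin

text \<open>
  If \<open>y' = v / w\<close> and \<open>v' = - w (q - m r) y\<close>, then \<open>(y\<^sup>2, 2 y v, v\<^sup>2)\<close> satisfies the linear system with
  matrix \<open>sym_square w (q - m r)\<close>, and \<open>S_mat\<close> conjugates it to \<open>Omega_hat\<close>.  In these coordinates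
  \<open>P2 (1 / w)\<close> is the symmetric square of the classical Darboux map
  \<open>y \<mapsto> (y' - \<theta> y) / sqrt_r\<close>, which turns the potential \<open>q\<close> into \<open>- \<rho>' - \<rho>\<^sup>2 - p \<rho>\<close>.  The whole claim
  therefore reduces to the identity \<open>P' = P W - W\<^sub>1 P\<close> for symmetric squares, conjugated by the
  constant matrix \<open>S_mat\<close>.
\<close>

text \<open>Turns the scalar prefactors, encoded as scalar matrices, into entrywise factors, so that
  the explicit matrices can be multiplied out.\<close>

lemma mat_matrix_mult: "mat c ** A = (\<chi> i j. c * A $ i $ j)"
  for A :: "'a::semiring_1^'n^'m"
  by (simp add: vec_eq_iff matrix_matrix_mult_def mat_def if_distrib[of "\<lambda>x. x * _"] sum.delta
      cong: if_cong)

lemma matrix_mult_diff_right: "A ** (B - C) = A ** B - A ** C"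
  for A :: "'a::ring_1^'n^'m"
  by (simp add: vec_eq_iff matrix_matrix_mult_def right_diff_distrib sum_subtractf)

lemma matrix_mult_diff_left: "(A - B) ** C = A ** C - B ** C"
  for A :: "'a::ring_1^'n^'m"
  by (simp add: vec_eq_iff matrix_matrix_mult_def left_diff_distrib sum_subtractf)

lemma matrix_inv_eqI:
  fixes A :: "'a::semiring_1^'n^'m"
  assumes "A ** B = mat 1" and "B ** A = mat 1"
  shows "matrix_inv A = B"
  unfolding matrix_inv_def
proof (rule some_equality)
  fix C assume "A ** C = mat 1 \<and> C ** A = mat 1"
  then show "C = B"
    using assms by (metis matrix_mul_assoc matrix_mul_lid matrix_mul_rid)
qed (use assms in simp)

locale derivation =
  fixes D :: "'a::field_char_0 \<Rightarrow> 'a"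
  assumes D: "is_derivation D"
begin

lemma add: "D (x + y) = D x + D y"
  and mult: "D (x * y) = D x * y + x * D y"
  using D by (auto simp: is_derivation_def)

lemma zero [simp]: "D 0 = 0"
  using add[of 0 0] by simp

lemma one [simp]: "D 1 = 0"
  using mult[of 1 1] by simp

lemma minus: "D (- x) = - D x"
  using add[of x "- x"] by (simp add: eq_neg_iff_add_eq_0 add.commute)

lemma diff: "D (x - y) = D x - D y"
  using add[of x "- y"] by (simp add: minus)

lemma two [simp]: "D 2 = 0"
  using add[of 1 1] by simp

lemma power2: "D (x\<^sup>2) = 2 * x * D x"
  by (simp add: power2_eq_square mult)

lemma divide: "y \<noteq> 0 \<Longrightarrow> D (x / y) = D x / y - x * D y / y\<^sup>2"
  using mult[of "x / y" y] by (simp add: field_simps power2_eq_square)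

lemma sum: "D (sum f I) = (\<Sum>i\<in>I. D (f i))"
  by (induction I rule: infinite_finite_induct) (simp_all add: add)

lemma matrix_mult: "map_matrix D (A ** B) = map_matrix D A ** B + A ** map_matrix D B"
  by (simp add: vec_eq_iff matrix_matrix_mult_def sum mult sum.distrib)

lemma matrix_vector_mult: "(\<chi> i. D ((A *v Z) $ i)) = map_matrix D A *v Z + A *v (\<chi> i. D (Z $ i))"
  by (simp add: vec_eq_iff matrix_vector_mult_def sum mult sum.distrib)

text \<open>The second assumption amounts to \<open>(T Z)' + B (T Z) = T (Z' + A Z)\<close> for
  every \<open>Z\<close>; since \<open>T\<close> is injective, both sides vanish together.
  Multiplying the assumption by the inverse of \<open>T\<close> yields the coefficient matrix
  \<open>B\<close>.\<close>

lemma gauge_transformationI: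
  assumes "invertible T" and "map_matrix D T = T ** A - B ** T"
  shows "gauge_transformation D T A B"
proof -
  obtain U where U: "T ** U = mat 1" "U ** T = mat 1"
    using assms(1) by (auto simp: invertible_def)
  then have "gauge_matrix D T A = B"
    by (simp add: gauge_matrix_def matrix_inv_eqI[OF U] assms(2) flip: matrix_mul_assoc)
  moreover have "solves_system D A Z \<longleftrightarrow> solves_system D B (T *v Z)" for Z
  proof -
    let ?Z' = "\<chi> i. D (Z $ i)"
    have "(\<chi> i. D ((T *v Z) $ i)) = T *v (?Z' + A *v Z) - B *v (T *v Z)"
      by (simp add: matrix_vector_mult assms(2) matrix_vector_mult_diff_rdistrib
          matrix_vector_right_distrib matrix_vector_mul_assoc)
    moreover have "T *v X = 0 \<longleftrightarrow> X = 0" for X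
      using assms(1) by (metis invertible_def matrix_left_invertible_ker matrix_vector_mult_0_right)
    ultimately show ?thesis
      by (simp add: solves_system_def eq_neg_iff_add_eq_0)
  qed
  ultimately show ?thesis
    using assms(1) by (simp add: gauge_transformation_def)
qed

end

definition sym_square :: "'a::field_char_0 \<Rightarrow> 'a \<Rightarrow> 'a^3^3" where
  "sym_square w q = vector [
     vector [0, - 1 / w, 0], vector [2 * w * q, 0, - 2 / w], vector [0, w * q, 0]]"

definition S_inv :: "'a::field_char_0 \<Rightarrow> 'a^3^3" where
  "S_inv im = vector [vector [1 / 2, 0, - im / 2], vector [0, - im, 0], vector [1 / 2, 0, im / 2]]"

lemmas matrix_3_simps = vec_eq_iff matrix_matrix_mult_def forall_3 sum_3 vector_3

lemma S_mat_inverse: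
  assumes "im\<^sup>2 = -1"
  shows "S_mat im ** S_inv im = mat 1" and "S_inv im ** S_mat im = mat 1"
  using assms by (simp_all add: S_mat_def S_inv_def mat_def matrix_3_simps power2_eq_square)

lemma matrix_inv_S_mat:
  assumes "im\<^sup>2 = -1"
  shows "matrix_inv (S_mat im) = S_inv im"
  by (intro matrix_inv_eqI S_mat_inverse assms)

text \<open>Adding \<open>m\<close> times \<open>N3_hat\<close> only shifts the potential in
  \<open>Omega0_hat\<close> from \<open>q\<close> to \<open>q - m * r\<close>. Writing the
  conjugation as an intertwining avoids the inverse of \<open>S_mat\<close>.\<close>

lemma Omega_hat_conjugate:
  assumes "im\<^sup>2 = -1" and "w \<noteq> 0"
  shows "Omega_hat im w r q m ** S_mat im = S_mat im ** sym_square w (q - m * r)"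
proof -
  have "im * im = -1" using assms(1) by (simp add: power2_eq_square)
  then have im: "im * (im * x) = - x" for x by (simp flip: mult.assoc)
  show ?thesis
    unfolding Omega_hat_def N3_hat_def mat_matrix_mult
    by (simp add: Omega0_hat_def S_mat_def sym_square_def matrix_3_simps field_simps im assms)
qed

lemma T2_conjugate:
  assumes "im\<^sup>2 = -1" and "u \<noteq> 0" and "r \<noteq> 0"
  shows "T2 im u r \<theta> \<rho> \<nu> ** S_mat im = S_mat im ** P2 u r \<theta> \<rho> \<nu>"
proof -
  have im: "im * (im * x) = - x" for x
    using assms(1) by (simp add: power2_eq_square flip: mult.assoc)
  show ?thesis
    unfolding T2_def P2_def mat_matrix_mult
    using assms by (simp add: S_mat_def matrix_3_simps field_simps im)
qed

text \<open>\<open>P2\<close> is the symmetric square of a 2x2 matrix with rows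
  \<open>(- \<theta>, u)\<close> and \<open>(\<nu> / u, \<rho>)\<close>, divided by a square root of
  \<open>r\<close>. That matrix has determinant \<open>- m\<close>, and the symmetric square cubes
  it.\<close>

lemma det_P2:
  assumes "u \<noteq> 0" and "r \<noteq> 0" and "\<nu> = m * r - \<rho> * \<theta>"
  shows "det (P2 u r \<theta> \<rho> \<nu>) = - (m ^ 3)"
  unfolding P2_def mat_matrix_mult
  using assms(1,2) by (simp add: det_3 assms(3) field_simps power2_eq_square power3_eq_cube)

context derivation
begin

text \<open>For \<open>y1 = (y' - \<theta> y) / sqrt_r\<close>, the Riccati equation of \<theta> and
  the formula for \<open>D r\<close> give \<open>y1' = (\<nu> y + \<rho> y') / sqrt_r\<close>; the
  Riccati equation of \<rho> then gives \<open>y1'' + p y1' + (q\<^sub>1 - m r) y1 = 0\<close>. The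
  identity is the symmetric square of this computation.\<close>

lemma P2_intertwines:
  assumes w: "w \<noteq> 0" "D w = p * w" and r: "r \<noteq> 0" "D r = - 2 * r * (\<theta> + p + \<rho>)" and m: "D m = 0"
    and \<theta>: "D \<theta> = - q - p * \<theta> - \<theta>\<^sup>2" and \<rho>: "D \<rho> = - q\<^sub>1 - p * \<rho> - \<rho>\<^sup>2"
    and \<nu>: "\<nu> = m * r - \<rho> * \<theta>"
  defines "P \<equiv> P2 (1 / w) r \<theta> \<rho> \<nu>"
  shows "map_matrix D P = P ** sym_square w (q - m * r) - sym_square w (q\<^sub>1 - m * r) ** P"
proof -
  have \<nu>': "D \<nu> = m * D r - D \<rho> * \<theta> - \<rho> * D \<theta>"
    by (simp add: \<nu> diff mult m)
  show ?thesis
    unfolding P_def P2_def mat_matrix_mult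
    using w(1) r(1)
    \<comment> \<open>All derivatives are eliminated while \<nu> is still a symbol; its value is
      inserted only for the remaining rational identity.\<close>
    by (simp add: sym_square_def matrix_3_simps
        mult divide minus diff power2 add \<nu>' w(2) r(2) \<theta> \<rho>)
      (simp add: \<nu> field_simps power2_eq_square power4_eq_xxxx)
qed

lemma sqrt:
  assumes "s\<^sup>2 = r" and "r \<noteq> 0"
  shows "D s = s * D r / (2 * r)"
  using assms by (auto simp: power2 power2_eq_square mult)

text \<open>The logarithmic derivative of \<open>1 / (y0 * sqrt_r)\<close> is
  \<open>\<rho> + p\<close>, so the expression differentiated in \<open>q_tilde\<close> collapses to
  \<open>- \<rho> / (y0 * sqrt_r)\<close>. Thus \<rho> satisfies the Riccati equation with potential
  \<open>q_tilde\<close>.\<close>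

lemma q_tilde_eq:
  assumes "y0 \<noteq> 0" and "r \<noteq> 0" and "sqrt_r\<^sup>2 = r" and "\<rho> = - D y0 / y0 - p - D r / (2 * r)"
  shows "q_tilde D p y0 sqrt_r = - D \<rho> - p * \<rho> - \<rho>\<^sup>2"
proof -
  define x where "x = y0 * sqrt_r"
  have x: "x \<noteq> 0" using assms by (auto simp: x_def)
  have y0: "D y0 = - (\<rho> + p + D r / (2 * r)) * y0"
    using assms by simp
  have "D x = - (\<rho> + p) * x"
    unfolding x_def mult y0 sqrt[OF assms(3,2)] by (simp add: algebra_simps)
  then have Dx: "D (1 / x) = (\<rho> + p) / x"
    using x by (simp add: divide power2_eq_square) (simp add: field_simps)
  then have "p / x - D (1 / x) = - \<rho> * (1 / x)"
    by (simp add: add_divide_distrib)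
  then have "D (p / x - D (1 / x)) = - D \<rho> * (1 / x) - \<rho> * ((\<rho> + p) / x)"
    by (simp only: mult minus Dx) simp
  then show ?thesis
    using x unfolding q_tilde_def x_def[symmetric] by (simp add: field_simps power2_eq_square)
qed

end

theorem corollary3p14:
  fixes D :: "'a::field_char_0 \<Rightarrow> 'a" and K L :: "'a set"
    and im p q r w y0 sqrt_r \<theta> \<rho> \<nu> m :: 'a
  assumes "is_derivation D"
    and "differential_subfield D K"
    and "algebraically_closed_subfield (constants D K)"
    and "im \<in> constants D K" and "im^2 = -1"
    and "p \<in> K" and "q \<in> K" and "r \<in> K" and "r \<noteq> 0"
    and "w \<in> K" and "w \<noteq> 0" and "p = D w / w"
    and "picard_vessiot D K p q L"
    and "y0 \<in> L" and "y0 \<noteq> 0" and "solves_equation D p q y0"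
    and "sqrt_r^2 = r"
    and "\<theta> = D y0 / y0"
    and "\<rho> = - \<theta> - p - D r / (2 * r)"
    and "\<nu> = m * r - \<rho> * \<theta>"
    and "m \<in> constants D K" and "m \<noteq> 0"
  shows "invertible (S_mat im) \<and>
         (\<forall>u. u \<noteq> 0 \<longrightarrow>
            T2 im u r \<theta> \<rho> \<nu> = S_mat im ** P2 u r \<theta> \<rho> \<nu> ** matrix_inv (S_mat im)) \<and>
         darboux_transformation D im w r q (q_tilde D p y0 sqrt_r) m (T2 im (1 / w) r \<theta> \<rho> \<nu>)"
proof -
  interpret derivation D by standard fact
  let ?S = "S_mat im" and ?W = "\<lambda>q. sym_square w (q - m * r)" and ?\<Omega> = "\<lambda>q. Omega_hat im w r q m"
  let ?P = "P2 (1 / w) r \<theta> \<rho> \<nu>" and ?T = "T2 im (1 / w) r \<theta> \<rho> \<nu>" and ?q = "q_tilde D p y0 sqrt_r"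
  note im = \<open>im\<^sup>2 = -1\<close>
  note S = S_mat_inverse[OF im]
  have S_cancel: "A = B" if "A ** ?S = B ** ?S" for A B :: "'a^3^3"
    using that S(1) by (metis matrix_mul_assoc matrix_mul_rid)
  have "invertible ?S"
    using S by (auto simp: invertible_def)
  moreover have "T2 im u r \<theta> \<rho> \<nu> = ?S ** P2 u r \<theta> \<rho> \<nu> ** matrix_inv ?S" if "u \<noteq> 0" for u
    using T2_conjugate[OF im that \<open>r \<noteq> 0\<close>, of \<theta> \<rho> \<nu>] S
    by (metis matrix_inv_S_mat[OF im] matrix_mul_assoc matrix_mul_rid)
  moreover have "darboux_transformation D im w r q ?q m ?T"
    unfolding darboux_transformation_def
  proof (rule gauge_transformationI)
    have TS: "?T ** ?S = ?S ** ?P"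
      by (rule T2_conjugate) (simp_all add: im \<open>w \<noteq> 0\<close> \<open>r \<noteq> 0\<close>)
    have \<Omega>S: "?\<Omega> q ** ?S = ?S ** ?W q" for q
      using Omega_hat_conjugate im \<open>w \<noteq> 0\<close> by blast
    \<comment> \<open>The determinant is \<open>- (m ^ 3)\<close>, so this is where
      \<open>m \<noteq> 0\<close> enters.\<close>
    have "det ?P \<noteq> 0"
      using det_P2[of "1 / w" r \<nu> m \<rho> \<theta>] assms by simp
    moreover have "det ?S \<noteq> 0"
      using \<open>invertible ?S\<close> by (simp add: invertible_det_nz)
    ultimately show "invertible ?T"
      using arg_cong[OF TS, of det] by (auto simp: invertible_det_nz det_mul)
    have "D (D y0) = - p * D y0 - q * y0"
      using \<open>solves_equation D p q y0\<close> by (simp add: solves_equation_def eq_neg_iff_add_eq_0 algebra_simps)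
    \<comment> \<open>The Riccati equation of the logarithmic derivative of
      \<open>y0\<close>.\<close>
    then have \<theta>': "D \<theta> = - q - p * \<theta> - \<theta>\<^sup>2"
      using \<open>y0 \<noteq> 0\<close> by (simp add: \<open>\<theta> = _\<close> divide diff_divide_distrib power2_eq_square)
    have \<rho>': "D \<rho> = - ?q - p * \<rho> - \<rho>\<^sup>2"
      using q_tilde_eq[of y0 r sqrt_r \<rho> p] assms by simp
    \<comment> \<open>The definition of \<rho>, solved for \<open>D r\<close>.\<close>
    have r': "D r = - 2 * r * (\<theta> + p + \<rho>)"
      using \<open>r \<noteq> 0\<close> by (simp add: \<open>\<rho> = _\<close>)
    have m': "D m = 0" and i': "D im = 0"
      using assms by (auto simp: constants_def)
    have P': "map_matrix D ?P = ?P ** ?W q - ?W ?q ** ?P"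
      by (rule P2_intertwines[OF \<open>w \<noteq> 0\<close> _ \<open>r \<noteq> 0\<close> r' m' \<theta>' \<rho>' \<open>\<nu> = _\<close>]) (simp add: \<open>p = _\<close> \<open>w \<noteq> 0\<close>)
    have S': "map_matrix D ?S = 0"
      by (simp add: S_mat_def vec_eq_iff forall_3 minus i')
    \<comment> \<open>As \<open>?S\<close> is constant, the identity for \<open>?P\<close> transfers
      to \<open>?T\<close> after right multiplication by \<open>?S\<close>, which is cancelled at
      the end.\<close>
    have "map_matrix D ?T ** ?S = map_matrix D (?T ** ?S)"
      by (simp add: matrix_mult S')
    also have "\<dots> = ?S ** (?P ** ?W q - ?W ?q ** ?P)"
      by (simp add: TS matrix_mult S' P')
    also have "\<dots> = (?T ** ?\<Omega> q - ?\<Omega> ?q ** ?T) ** ?S"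
      \<comment> \<open>\<open>?S\<close> has to pass two factors: the nearer one with products
        nested to the right, the other with products nested to the left.\<close>
      by (simp add: matrix_mult_diff_right matrix_mult_diff_left TS \<Omega>S flip: matrix_mul_assoc)
         (simp add: matrix_mul_assoc TS \<Omega>S)
    finally show "map_matrix D ?T = ?T ** ?\<Omega> q - ?\<Omega> ?q ** ?T"
      by (rule S_cancel)
  qed
  ultimately show ?thesis by blast
qed

end
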